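(* Let $f(x_1,x_2,x_3,x_4)$ be a form of degree $d\ge 4$ with integer coefficients such that the equation $f(x_1,x_2,x_3,x_4)=0$ satisfies the properties $D_1$, $D_2$, $D_3$ stated in the context, and let $\phi_0,\phi_1,\phi_2$ be the polynomials occurring in property $D_3$. If the equation $f(x_1,x_2,x_3,x_4)=0$ has infinitely many solutions, then the equation $$\phi_1^2(m_1,m_2)-4\phi_0(m_1,m_2)\phi_2(m_1,m_2)=z^2$$ in the variables $m_1,m_2,z$ has infinitely many solutions in rational numbers.
   Context: Rational solutions $(\alpha_1,\dots,\alpha_4)$ and $(k\alpha_1,\dots,k\alpha_4)$, $k\in\mathbb{Q}\setminus\{0\}$, of $f=0$ are considered equivalent and counted as the same solution. Throughout, a solution of $f=0$ means a rational one for which $(x_1,x_2)\neq(0,0)$ and $(x_3,x_4)\neq(0,0)$. Property $D_1$: at least one integer solution $(\alpha_1,\alpha_2,\alpha_3,\alpha_4)$ of $f=0$ with $(\alpha_1,\alpha_2)\ne(0,0)$ and $(\alpha_3,\alpha_4)\neq(0,0)$ is known (exists). Property $D_2$: $f(x_1,x_2,x_3,x_4)=f(-x_1,x_2,x_3,x_4)$. Property $D_3$: there exist bilinear forms $B_1(m_1,m_2,x_1,x_2)$, $B_2(m_1,m_2,x_1,x_2)$ (bilinear in $(m_1,m_2)$ and $(x_1,x_2)$) with rational coefficients such that: (i) for all rational $(x_1,x_2)\ne(0,0)$, $B_1,B_2$ are linearly independent linear forms in $m_1,m_2$; and for all rational $(m_1,m_2)\neq(0,0)$, $B_1,B_2$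 are linearly independent linear forms in $x_1,x_2$; (ii) on substituting $x_3=B_1(m_1,m_2,x_1,x_2)$, $x_4=B_2(m_1,m_2,x_1,x_2)$, the equation $f=0$ becomes $$\psi(x_1,x_2)\{\phi_0(m_1,m_2)x_1^2+\phi_1(m_1,m_2)x_1x_2+\phi_2(m_1,m_2)x_2^2\}=0,$$ where $\psi$ is a binary form of degree $d-2$ such that $\psi(x_1,x_2)=0$ has no rational solution $(x_1,x_2)\neq(0,0)$, and $\phi_0,\phi_1,\phi_2$ are polynomials (with rational coefficients) which do not vanish simultaneously for any rational $(m_1,m_2)\neq(0,0)$. *)

theory Defs
  imports "HOL-Analysis.Analysis" "HOL-Library.Poly_Mapping"
begin

text \<open>
  A polynomial in the variables indexed by the finite type \<open>'n\<close> is a finitely supported map from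
  exponent vectors to coefficients. The variables \<open>x\<^sub>1, \<dots>, x\<^sub>4\<close> are indexed by the numeral
  type \<open>4\<close>, and the variables of the binary polynomials by the numeral type \<open>2\<close>.
\<close>

type_synonym ('n, 'a) mpoly = "('n \<Rightarrow>\<^sub>0 nat) \<Rightarrow>\<^sub>0 'a"

definition mpoly_eval :: "('n::finite, 'a::comm_semiring_1) mpoly \<Rightarrow> 'a ^ 'n \<Rightarrow> 'a" where
  "mpoly_eval p x =
     (\<Sum>t\<in>Poly_Mapping.keys p. Poly_Mapping.lookup p t * (\<Prod>i\<in>UNIV. (x $ i) ^ Poly_Mapping.lookup t i))"

definition is_form :: "nat \<Rightarrow> ('n::finite, 'a::zero) mpoly \<Rightarrow> bool" where
  "is_form d p \<longleftrightarrow>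
     p \<noteq> 0 \<and> (\<forall>t\<in>Poly_Mapping.keys p. (\<Sum>i\<in>UNIV. Poly_Mapping.lookup t i) = d)"

definition integer_coeffs :: "('n, rat) mpoly \<Rightarrow> bool" where
  "integer_coeffs p \<longleftrightarrow> (\<forall>t. Poly_Mapping.lookup p t \<in> \<int>)"

definition solutions :: "(4, rat) mpoly \<Rightarrow> (rat ^ 4) set" where
  "solutions f =
     {x. mpoly_eval f x = 0 \<and> (x $ 1, x $ 2) \<noteq> (0, 0) \<and> (x $ 3, x $ 4) \<noteq> (0, 0)}"

definition proportional :: "((rat ^ 4) \<times> (rat ^ 4)) set" where
  "proportional = {(x, y). \<exists>k. k \<noteq> 0 \<and> y = k *s x}"

lemma equiv_proportional: "equiv UNIV proportional"
proof (rule equivI)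
  show "refl proportional"
    by (auto simp: refl_on_def proportional_def intro!: exI[of _ 1])
  show "sym proportional"
    by (auto simp: sym_def proportional_def intro: exI[of _ "inverse _"])
  show "trans proportional"
    unfolding trans_def proportional_def
    by clarsimp (metis mult_eq_0_iff)
qed simp

definition has_infinitely_many_solutions :: "(4, rat) mpoly \<Rightarrow> bool" where
  "has_infinitely_many_solutions f \<longleftrightarrow> infinite (solutions f // proportional)"

definition property_D1 :: "(4, rat) mpoly \<Rightarrow> bool" where
  "property_D1 f \<longleftrightarrow> (\<exists>\<alpha>\<in>solutions f. \<forall>i. \<alpha> $ i \<in> \<int>)"

definition property_D2 :: "(4, rat) mpoly \<Rightarrow> bool" where
  "property_D2 f \<longleftrightarrow>
     (\<forall>x1 x2 x3 x4. mpoly_eval f (vector [x1, x2, x3, x4]) = mpoly_eval f (vector [- x1, x2, x3, x4]))"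

definition bilinear_form :: "(rat ^ 2 \<Rightarrow> rat ^ 2 \<Rightarrow> rat) \<Rightarrow> bool" where
  "bilinear_form B \<longleftrightarrow>
     (\<forall>m. Vector_Spaces.linear (*s) (*) (\<lambda>x. B m x)) \<and>
     (\<forall>x. Vector_Spaces.linear (*s) (*) (\<lambda>m. B m x))"

definition independent_forms :: "(rat ^ 2 \<Rightarrow> rat) \<Rightarrow> (rat ^ 2 \<Rightarrow> rat) \<Rightarrow> bool" where
  "independent_forms L1 L2 \<longleftrightarrow> (\<forall>a b. (\<forall>u. a * L1 u + b * L2 u = 0) \<longrightarrow> a = 0 \<and> b = 0)"

text \<open>
  Over the infinite field of rationals the polynomial identity resulting from the substitution
  is the same as equality of values at all rational arguments.
\<close>

definition property_D3 ::
  "nat \<Rightarrow> (4, rat) mpoly \<Rightarrow> (rat ^ 2 \<Rightarrow> rat ^ 2 \<Rightarrow> rat) \<Rightarrow> (rat ^ 2 \<Rightarrow> rat ^ 2 \<Rightarrow> rat) \<Rightarrow>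
   (2, rat) mpoly \<Rightarrow> (2, rat) mpoly \<Rightarrow> (2, rat) mpoly \<Rightarrow> (2, rat) mpoly \<Rightarrow> bool" where
  "property_D3 d f B1 B2 \<psi> \<phi>0 \<phi>1 \<phi>2 \<longleftrightarrow>
     bilinear_form B1 \<and> bilinear_form B2 \<and>
     (\<forall>x. x \<noteq> 0 \<longrightarrow> independent_forms (\<lambda>m. B1 m x) (\<lambda>m. B2 m x)) \<and>
     (\<forall>m. m \<noteq> 0 \<longrightarrow> independent_forms (\<lambda>x. B1 m x) (\<lambda>x. B2 m x)) \<and>
     (\<forall>m x. mpoly_eval f (vector [x $ 1, x $ 2, B1 m x, B2 m x]) =
        mpoly_eval \<psi> x *
          (mpoly_eval \<phi>0 m * (x $ 1)\<^sup>2 + mpoly_eval \<phi>1 m * (x $ 1) * (x $ 2) +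
           mpoly_eval \<phi>2 m * (x $ 2)\<^sup>2)) \<and>
     is_form (d - 2) \<psi> \<and>
     (\<forall>x. x \<noteq> 0 \<longrightarrow> mpoly_eval \<psi> x \<noteq> 0) \<and>
     (\<forall>m. m \<noteq> 0 \<longrightarrow>
        \<not> (mpoly_eval \<phi>0 m = 0 \<and> mpoly_eval \<phi>1 m = 0 \<and> mpoly_eval \<phi>2 m = 0))"

end

theory Submission
  imports Defs "HOL-Computational_Algebra.Polynomial"
begin

text \<open>
  The surface \<open>f = 0\<close> is fibred by \<open>m\<close>. A solution whose first two coordinates form
  \<open>x \<noteq> 0\<close> determines a pair \<open>m\<close> with \<open>x\<^sub>3 = B\<^sub>1(m, x)\<close> and \<open>x\<^sub>4 = B\<^sub>2(m, x)\<close>, because \<open>B\<^sub>1\<close> and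
  \<open>B\<^sub>2\<close> are independent linear forms in \<open>m\<close> (\<open>independent_forms_surj\<close>); and \<open>m \<noteq> 0\<close> because
  \<open>(x\<^sub>3, x\<^sub>4) \<noteq> (0, 0)\<close>. Since \<open>\<psi>(x) \<noteq> 0\<close>, the quadratic form \<open>\<phi>\<^sub>0(m), \<phi>\<^sub>1(m), \<phi>\<^sub>2(m)\<close> vanishes at
  \<open>x\<close>, so its discriminant is a square (\<open>discriminant_square\<close>).

  Each fibre contains only finitely many solutions up to scaling: a nonzero binary quadratic form
  has finitely many projective zeros (\<open>finite_directions\<close>), and the whole solution is linear in
  \<open>x\<close> once \<open>m\<close> is fixed. Hence infinitely many classes of solutions require infinitely many \<open>m\<close>,
  all of which make the discriminant a square.
\<close>

lemma linear_form_coordinates: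
  fixes L :: "rat ^ 2 \<Rightarrow> rat"
  assumes "Vector_Spaces.linear (*s) (*) L"
  shows "L u = u $ 1 * L (axis 1 1) + u $ 2 * L (axis 2 1)"
proof -
  interpret L: Vector_Spaces.linear "(*s)" "(*)" L
    by (rule assms)
  have "u = u $ 1 *s axis 1 1 + u $ 2 *s axis 2 1"
    by (simp add: vec_eq_iff forall_2 axis_def)
  then have "L u = L (u $ 1 *s axis 1 1 + u $ 2 *s axis 2 1)"
    by simp
  then show ?thesis
    by (simp add: L.add L.scale)
qed

text \<open>
  Independence says that the determinant of the two forms is nonzero, so that Cramer's rule applies.
\<close>

lemma independent_forms_surj:
  assumes "Vector_Spaces.linear (*s) (*) L1" "Vector_Spaces.linear (*s) (*) L2"
    and "independent_forms L1 L2"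
  shows "\<exists>u. L1 u = a \<and> L2 u = b"
proof -
  define p q r s where "p = L1 (axis 1 1)" and "q = L1 (axis 2 1)"
    and "r = L2 (axis 1 1)" and "s = L2 (axis 2 1)"
  have L1: "L1 u = u $ 1 * p + u $ 2 * q" and L2: "L2 u = u $ 1 * r + u $ 2 * s" for u
    using linear_form_coordinates assms(1,2) unfolding p_def q_def r_def s_def by blast+
  have det: "p * s - q * r \<noteq> 0"
  proof
    assume det0: "p * s - q * r = 0"
    \<comment> \<open>The rows of the adjugate matrix give linear relations between the two forms.\<close>
    have "s * L1 u + (- q) * L2 u = u $ 1 * (p * s - q * r)"
      "r * L1 u + (- p) * L2 u = - u $ 2 * (p * s - q * r)" for u
      by (simp_all add: L1 L2 algebra_simps)
    then have "\<forall>u. s * L1 u + (- q) * L2 u = 0" "\<forall>u. r * L1 u + (- p) * L2 u = 0"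
      using det0 by simp_all
    then have "s = 0 \<and> - q = 0" "r = 0 \<and> - p = 0"
      using assms(3) unfolding independent_forms_def by blast+
    then have "\<forall>u. 1 * L1 u + 0 * L2 u = 0"
      by (simp add: L1)
    then show False
      using assms(3) unfolding independent_forms_def by (metis zero_neq_one)
  qed
  define D where "D = p * s - q * r"
  define u :: "rat ^ 2" where "u = vector [(a * s - q * b) / D, (p * b - a * r) / D]"
  have "L1 u = a * D / D" "L2 u = b * D / D"
    by (simp_all add: L1 L2 u_def D_def algebra_simps flip: add_divide_distrib diff_divide_distrib)
  then have "L1 u = a \<and> L2 u = b"
    using det by (simp add: D_def)
  then show ?thesis by blast
qed

lemma discriminant_square:
  fixes a b c x y :: "'a::field"
  assumes zero: "a * x\<^sup>2 + b * x * y + c * y\<^sup>2 = 0" and nonzero: "x \<noteq> 0 \<or> y \<noteq> 0"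
  shows "\<exists>z. b\<^sup>2 - 4 * a * c = z\<^sup>2"
proof (cases "y = 0")
  case True
  then have "a = 0" using assms by simp
  then show ?thesis by auto
next
  case False
  \<comment> \<open>Completing the square: \<open>(2ax + by)\<^sup>2 - (b\<^sup>2 - 4ac)y\<^sup>2\<close> is \<open>4a\<close> times the form.\<close>
  have "(b\<^sup>2 - 4 * a * c) * y\<^sup>2 = (2 * a * x + b * y)\<^sup>2"
    using zero by algebra
  then have "b\<^sup>2 - 4 * a * c = ((2 * a * x + b * y) / y)\<^sup>2"
    using False by (simp add: power_divide eq_divide_eq)
  then show ?thesis ..
qed

text \<open>
  The projective line is covered by the point at infinity and the affine points \<open>(t, 1)\<close>, on which
  the form is a nonzero polynomial in \<open>t\<close>.
\<close>

lemma finite_directions: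
  fixes a b c :: rat
  assumes "\<not> (a = 0 \<and> b = 0 \<and> c = 0)"
  obtains R :: "(rat ^ 2) set" where "finite R"
    and "\<And>x. x \<noteq> 0 \<Longrightarrow> a * (x $ 1)\<^sup>2 + b * x $ 1 * x $ 2 + c * (x $ 2)\<^sup>2 = 0 \<Longrightarrow>
           \<exists>r\<in>R. \<exists>k. k \<noteq> 0 \<and> x = k *s r"
proof
  let ?T = "{t. poly [:c, b, a:] t = 0}"
  let ?R = "insert (vector [1, 0]) ((\<lambda>t. vector [t, 1]) ` ?T) :: (rat ^ 2) set"
  show "finite ?R"
    using assms by (intro finite.insertI finite_imageI poly_roots_finite) auto
  fix x :: "rat ^ 2"
  assume x: "x \<noteq> 0" "a * (x $ 1)\<^sup>2 + b * x $ 1 * x $ 2 + c * (x $ 2)\<^sup>2 = 0"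
  show "\<exists>r\<in>?R. \<exists>k. k \<noteq> 0 \<and> x = k *s r"
  proof (cases "x $ 2 = 0")
    case True
    then have "x $ 1 \<noteq> 0 \<and> x = x $ 1 *s vector [1, 0]"
      using x(1) by (auto simp: vec_eq_iff forall_2)
    then show ?thesis by blast
  next
    case False
    then have "x = x $ 2 *s vector [x $ 1 / x $ 2, 1]"
      by (simp add: vec_eq_iff forall_2)
    moreover have "poly [:c, b, a:] (x $ 1 / x $ 2) = 0"
      using x(2) False by (simp add: field_simps power2_eq_square)
    ultimately show ?thesis
      using False by blast
  qed
qed

definition fibre_point ::
  "(rat ^ 2 \<Rightarrow> rat ^ 2 \<Rightarrow> rat) \<Rightarrow> (rat ^ 2 \<Rightarrow> rat ^ 2 \<Rightarrow> rat) \<Rightarrow> rat ^ 2 \<Rightarrow> rat ^ 2 \<Rightarrow> rat ^ 4" where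
  "fibre_point B1 B2 m x = vector [x $ 1, x $ 2, B1 m x, B2 m x]"

lemma vector_4_nth:
  fixes a b c d :: "'a::zero"
  shows "(vector [a, b, c, d] :: 'a ^ 4) $ 1 = a" "(vector [a, b, c, d] :: 'a ^ 4) $ 2 = b"
    "(vector [a, b, c, d] :: 'a ^ 4) $ 3 = c" "(vector [a, b, c, d] :: 'a ^ 4) $ 4 = d"
  by (simp_all add: vector_def)

lemma fibre_point_scale:
  assumes "bilinear_form B1" "bilinear_form B2"
  shows "fibre_point B1 B2 m (k *s x) = k *s fibre_point B1 B2 m x"
proof -
  have lin: "Vector_Spaces.linear (*s) (*) (B1 m)" "Vector_Spaces.linear (*s) (*) (B2 m)"
    using assms unfolding bilinear_form_def by blast+
  have "B1 m (k *s x) = k * B1 m x" "B2 m (k *s x) = k * B2 m x"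
    using linear_form_coordinates[OF lin(1)] linear_form_coordinates[OF lin(2)]
    by (metis (no_types, lifting) distrib_left mult.assoc vector_smult_component)+
  then show ?thesis
    by (simp add: fibre_point_def vec_eq_iff forall_4 vector_4_nth)
qed

lemma solution_on_fibre:
  assumes D3: "property_D3 d f B1 B2 \<psi> \<phi>0 \<phi>1 \<phi>2" and sol: "\<alpha> \<in> solutions f"
  obtains m x where "m \<noteq> 0" "x \<noteq> 0" "\<alpha> = fibre_point B1 B2 m x"
    "mpoly_eval \<phi>0 m * (x $ 1)\<^sup>2 + mpoly_eval \<phi>1 m * x $ 1 * x $ 2 +
       mpoly_eval \<phi>2 m * (x $ 2)\<^sup>2 = 0"
proof -
  define x :: "rat ^ 2" where "x = vector [\<alpha> $ 1, \<alpha> $ 2]"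
  have x: "x \<noteq> 0" and \<alpha>34: "(\<alpha> $ 3, \<alpha> $ 4) \<noteq> (0, 0)" and f0: "mpoly_eval f \<alpha> = 0"
    using sol by (auto simp: solutions_def x_def vec_eq_iff forall_2)
  have "bilinear_form B1" "bilinear_form B2"
    using D3 by (simp_all add: property_D3_def)
  then have lin: "Vector_Spaces.linear (*s) (*) (\<lambda>m. B1 m x)"
    "Vector_Spaces.linear (*s) (*) (\<lambda>m. B2 m x)"
    unfolding bilinear_form_def by blast+
  moreover have "independent_forms (\<lambda>m. B1 m x) (\<lambda>m. B2 m x)"
    using D3 x by (simp add: property_D3_def)
  ultimately obtain m where m: "B1 m x = \<alpha> $ 3" "B2 m x = \<alpha> $ 4"
    using independent_forms_surj[of "\<lambda>m. B1 m x" "\<lambda>m. B2 m x"] by blast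
  have "m \<noteq> 0"
  proof
    assume "m = 0"
    then have "B1 m x = 0" "B2 m x = 0"
      using linear_form_coordinates[OF lin(1), of m] linear_form_coordinates[OF lin(2), of m]
      by simp_all
    then show False using m \<alpha>34 by simp
  qed
  have \<alpha>: "\<alpha> = fibre_point B1 B2 m x"
    by (simp add: fibre_point_def x_def m[unfolded x_def] vec_eq_iff forall_4 vector_4_nth)
  have "mpoly_eval \<psi> x * (mpoly_eval \<phi>0 m * (x $ 1)\<^sup>2 + mpoly_eval \<phi>1 m * x $ 1 * x $ 2 +
          mpoly_eval \<phi>2 m * (x $ 2)\<^sup>2) = mpoly_eval f \<alpha>"
    using D3 unfolding property_D3_def \<alpha> fibre_point_def by simp
  moreover have "mpoly_eval \<psi> x \<noteq> 0"
    using D3 x by (simp add: property_D3_def)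
  ultimately show ?thesis
    using that[OF \<open>m \<noteq> 0\<close> x \<alpha>] f0 by simp
qed

lemma finite_classes_of_finite_fibres:
  assumes D3: "property_D3 d f B1 B2 \<psi> \<phi>0 \<phi>1 \<phi>2" and "finite M"
    and M: "\<And>m z. m \<noteq> 0 \<Longrightarrow>
      (mpoly_eval \<phi>1 m)\<^sup>2 - 4 * mpoly_eval \<phi>0 m * mpoly_eval \<phi>2 m = z\<^sup>2 \<Longrightarrow> m \<in> M"
  shows "finite (solutions f // proportional)"
proof -
  define Q where "Q m x \<longleftrightarrow> mpoly_eval \<phi>0 m * (x $ 1)\<^sup>2 + mpoly_eval \<phi>1 m * x $ 1 * x $ 2 +
    mpoly_eval \<phi>2 m * (x $ 2)\<^sup>2 = 0" for m x :: "rat ^ 2"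
  have "\<exists>R. finite R \<and> (\<forall>x. x \<noteq> 0 \<longrightarrow> Q m x \<longrightarrow> (\<exists>r\<in>R. \<exists>k. k \<noteq> 0 \<and> x = k *s r))"
    if "m \<noteq> 0" for m
  proof -
    have "\<not> (mpoly_eval \<phi>0 m = 0 \<and> mpoly_eval \<phi>1 m = 0 \<and> mpoly_eval \<phi>2 m = 0)"
      using D3 that unfolding property_D3_def by blast
    from finite_directions[OF this] show ?thesis
      unfolding Q_def by metis
  qed
  then obtain R where R: "\<And>m. m \<noteq> 0 \<Longrightarrow> finite (R m)"
    "\<And>m x. m \<noteq> 0 \<Longrightarrow> x \<noteq> 0 \<Longrightarrow> Q m x \<Longrightarrow> \<exists>r\<in>R m. \<exists>k. k \<noteq> 0 \<and> x = k *s r"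
    by metis
  let ?P = "SIGMA m:M - {0}. R m"
  have "solutions f // proportional \<subseteq> (\<lambda>(m, r). proportional `` {fibre_point B1 B2 m r}) ` ?P"
  proof
    fix C assume "C \<in> solutions f // proportional"
    then obtain \<alpha> where \<alpha>: "\<alpha> \<in> solutions f" and C: "C = proportional `` {\<alpha>}"
      by (auto elim: quotientE)
    obtain m x where m: "m \<noteq> 0" and x: "x \<noteq> 0" "\<alpha> = fibre_point B1 B2 m x" and Q: "Q m x"
      using solution_on_fibre[OF D3 \<alpha>] unfolding Q_def by metis
    have "x $ 1 \<noteq> 0 \<or> x $ 2 \<noteq> 0"
      using x(1) by (auto simp: vec_eq_iff forall_2)
    then have "m \<in> M"
      using M[OF m] discriminant_square[OF Q[unfolded Q_def]] by blast
    obtain r k where r: "r \<in> R m" and k: "k \<noteq> 0" "x = k *s r"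
      using R(2)[OF m x(1) Q] by blast
    have "\<alpha> = k *s fibre_point B1 B2 m r"
      using D3 by (simp add: x(2) k(2) fibre_point_scale property_D3_def)
    then have "(fibre_point B1 B2 m r, \<alpha>) \<in> proportional"
      using k(1) unfolding proportional_def by blast
    then have "C = proportional `` {fibre_point B1 B2 m r}"
      using equiv_class_eq[OF equiv_proportional] C by simp
    then show "C \<in> (\<lambda>(m, r). proportional `` {fibre_point B1 B2 m r}) ` ?P"
      using m r \<open>m \<in> M\<close> by force
  qed
  moreover have "finite ?P"
    using \<open>finite M\<close> R(1) by blast
  ultimately show ?thesis
    by (meson finite_imageI finite_subset)
qed

theorem mainTheorem2:
  fixes d :: nat and f :: "(4, rat) mpoly"
    and B1 B2 :: "rat ^ 2 \<Rightarrow> rat ^ 2 \<Rightarrow> rat"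
    and \<psi> \<phi>0 \<phi>1 \<phi>2 :: "(2, rat) mpoly"
  assumes "d \<ge> 4" and "is_form d f" and "integer_coeffs f"
    and "property_D1 f" and "property_D2 f" and "property_D3 d f B1 B2 \<psi> \<phi>0 \<phi>1 \<phi>2"
    and "has_infinitely_many_solutions f"
  shows "infinite {(m1 :: rat, m2 :: rat, z :: rat).
           (mpoly_eval \<phi>1 (vector [m1, m2]))\<^sup>2
             - 4 * mpoly_eval \<phi>0 (vector [m1, m2]) * mpoly_eval \<phi>2 (vector [m1, m2]) = z\<^sup>2}"
proof
  let ?T = "{(m1 :: rat, m2 :: rat, z :: rat).
           (mpoly_eval \<phi>1 (vector [m1, m2]))\<^sup>2
             - 4 * mpoly_eval \<phi>0 (vector [m1, m2]) * mpoly_eval \<phi>2 (vector [m1, m2]) = z\<^sup>2}"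
  let ?M = "(\<lambda>(m1, m2, z). vector [m1, m2]) ` ?T :: (rat ^ 2) set"
  assume "finite ?T"
  then have "finite ?M"
    by (rule finite_imageI)
  moreover have "m \<in> ?M"
    if "(mpoly_eval \<phi>1 m)\<^sup>2 - 4 * mpoly_eval \<phi>0 m * mpoly_eval \<phi>2 m = z\<^sup>2" for m z
  proof -
    have m: "vector [m $ 1, m $ 2] = m"
      by (simp add: vec_eq_iff forall_2)
    show ?thesis
      using that by (intro image_eqI[where x = "(m $ 1, m $ 2, z)"]) (simp_all add: m)
  qed
  ultimately have "finite (solutions f // proportional)"
    using finite_classes_of_finite_fibres[OF assms(6), of ?M] by blast
  then show False
    using assms(7) unfolding has_infinitely_many_solutions_def by blast
qed

end
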